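(* Let $H$ be a finite-dimensional real Hilbert space, let $A, B : H \to H$ be constant (time-independent) linear operators with $A \ge 0$ and $B = B^* > 0$, let $m \ge 1$, and let $a_i > 0$, $b_i > 0$ for $i = 1,2,\ldots,m$. Let $T>0$, $u^0 \in H$, and let $u, u_1, \ldots, u_m : [0,T] \to H$ be a solution of the Cauchy problem $$\frac{du}{dt} + A u + \sum_{i=1}^{m} a_i B u_i = 0, \qquad \frac{du_i}{dt} + b_i u_i - u = 0, \quad i = 1,2,\ldots,m, \qquad 0 < t \le T,$$ $$u(0) = u^0, \qquad u_i(0) = 0, \quad i = 1,2,\ldots,m.$$ Then $$\|u(t)\|^2 + \sum_{i=1}^{m} a_i \|u_i(t)\|_B^2 \le \|u^0\|^2, \qquad 0 < t \le T.$$
   Context: $(\cdot,\cdot)$ and $\|\cdot\|$ denote the inner product and norm of $H$. For an operator $A$ (not necessarily self-adjoint), $A \ge 0$ means $(Av,v) \ge 0$ for all $v \in H$; $B > 0$ means $(Bv,v) > 0$ for all $v \neq 0$. For $B = B^* > 0$, $\|v\|_B = (Bv,v)^{1/2}$. A solution is a tuple of functions continuous on $[0,T]$ and differentiable on $(0,T]$ that satisfies the equations and the initial conditions. (The system arises from $\frac{du}{dt} + Au + \int_0^t k(t-s) B u(s)\,ds = 0$ with $k(t) = \sum_{i=1}^m a_i e^{-b_i t}$ by setting $u_i(t) = \int_0^t e^{-b_i(t-s)} u(s)\,ds$.) *)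

theory Defs
  imports "HOL-Analysis.Analysis"
begin

text \<open>
  A finite-dimensional real Hilbert space is a type of class \<open>real_inner\<close> spanned by a finite set;
  unlike \<open>euclidean_space\<close>, this admits dimension zero. Completeness is automatic.
\<close>

definition finite_dimensional :: "'a::real_inner itself \<Rightarrow> bool" where
  "finite_dimensional (_ :: 'a itself) \<longleftrightarrow> (\<exists>S :: 'a set. finite S \<and> span S = UNIV)"

definition nonneg_op :: "('a::real_inner \<Rightarrow> 'a) \<Rightarrow> bool" where
  "nonneg_op A \<longleftrightarrow> (\<forall>v. A v \<bullet> v \<ge> 0)"

definition pos_op :: "('a::real_inner \<Rightarrow> 'a) \<Rightarrow> bool" where
  "pos_op B \<longleftrightarrow> (\<forall>v. v \<noteq> 0 \<longrightarrow> B v \<bullet> v > 0)"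

definition norm_wrt :: "('a::real_inner \<Rightarrow> 'a) \<Rightarrow> 'a \<Rightarrow> real" where
  "norm_wrt B v = sqrt (B v \<bullet> v)"

text \<open>
  \<open>v i\<close> is the auxiliary function \<open>u\<^sub>i\<close>. Relative to \<open>{0..T}\<close>, the derivative
  is two-sided for \<open>0 < t < T\<close> and the left one at \<open>t = T\<close>. The functions are total, but their
  values outside \<open>{0..T}\<close> play no role.
\<close>

definition cauchy_solution ::
  "('a::real_inner \<Rightarrow> 'a) \<Rightarrow> ('a \<Rightarrow> 'a) \<Rightarrow> nat \<Rightarrow> (nat \<Rightarrow> real) \<Rightarrow> (nat \<Rightarrow> real) \<Rightarrow> real \<Rightarrow> 'a \<Rightarrow>
    (real \<Rightarrow> 'a) \<Rightarrow> (nat \<Rightarrow> real \<Rightarrow> 'a) \<Rightarrow> bool" where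
  "cauchy_solution A B m a b T u0 u v \<longleftrightarrow>
     continuous_on {0..T} u \<and>
     (\<forall>i\<in>{1..m}. continuous_on {0..T} (v i)) \<and>
     (\<forall>t\<in>{0<..T}. u differentiable (at t within {0..T})) \<and>
     (\<forall>i\<in>{1..m}. \<forall>t\<in>{0<..T}. v i differentiable (at t within {0..T})) \<and>
     (\<forall>t\<in>{0<..T}. vector_derivative u (at t within {0..T}) + A (u t)
        + (\<Sum>i=1..m. a i *\<^sub>R B (v i t)) = 0) \<and>
     (\<forall>i\<in>{1..m}. \<forall>t\<in>{0<..T}. vector_derivative (v i) (at t within {0..T})
        + b i *\<^sub>R v i t - u t = 0) \<and>
     u 0 = u0 \<and>
     (\<forall>i\<in>{1..m}. v i 0 = 0)"

text \<open>
  The library constant \<open>adjoint\<close> is an \<open>SOME\<close> whose characteristic property is proved there only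
  for \<open>euclidean_space\<close>. It also holds under \<open>finite_dimensional\<close>, so \<open>adjoint B = B\<close> is
  self-adjointness there.
\<close>

lemma finite_span_riesz:
  fixes S :: "'a::real_inner set"
  assumes "finite S" "linear (f :: 'a \<Rightarrow> real)"
  shows "\<exists>w\<in>span S. \<forall>x\<in>span S. f x = w \<bullet> x"
  using assms
proof (induction S arbitrary: f rule: finite_induct)
  case empty
  then show ?case by (auto simp: linear_0)
next
  case (insert s S)
  obtain p where p: "p \<in> span S" "\<forall>x\<in>span S. s \<bullet> x = p \<bullet> x"
    using insert.IH[of "\<lambda>x. s \<bullet> x"]
    by (metis bounded_linear.linear bounded_linear_inner_right)
  obtain w where w: "w \<in> span S" "\<forall>x\<in>span S. f x = w \<bullet> x"
    using insert.IH[OF insert.prems] by blast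
  define e where "e = s - p"
  have e: "e \<bullet> x = 0" if "x \<in> span S" for x
    using p(2) that by (simp add: e_def inner_diff_left)
  have mono: "span S \<subseteq> span (insert s S)" by (rule span_mono) auto
  have eS: "e \<in> span (insert s S)"
    unfolding e_def by (rule span_diff) (use p(1) mono in \<open>auto simp: span_base\<close>)
  define z where "z = w + (f e / (e \<bullet> e)) *\<^sub>R e"
  have "z \<in> span (insert s S)"
    unfolding z_def by (intro span_add span_scale eS subsetD[OF mono w(1)])
  moreover have "f x = z \<bullet> x" if x: "x \<in> span (insert s S)" for x
  proof -
    obtain k where k: "x - k *\<^sub>R s \<in> span S" using x by (auto simp only: span_insert mem_Collect_eq)
    define y where "y = x - k *\<^sub>R s + k *\<^sub>R p"
    have y: "y \<in> span S" unfolding y_def by (intro span_add span_scale k p(1))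
    have x_eq: "x = y + k *\<^sub>R e" by (simp add: y_def e_def algebra_simps)
    have fx: "f x = f y + k * f e"
      unfolding x_eq using insert.prems by (simp add: linear_add linear_scale)
    have "w \<bullet> e = 0" using e[OF w(1)] by (simp add: inner_commute)
    moreover have "f e / (e \<bullet> e) * (e \<bullet> e) = f e"
      using insert.prems by (cases "e = 0") (auto simp: linear_0)
    ultimately have "z \<bullet> x = w \<bullet> y + k * f e"
      unfolding x_eq z_def using e[OF y] by (simp add: inner_add_left inner_add_right)
    then show ?thesis using fx w(2) y by simp
  qed
  ultimately show ?case by blast
qed

lemma finite_dimensional_adjoint_works:
  fixes f :: "'a::real_inner \<Rightarrow> 'a"
  assumes fd: "finite_dimensional TYPE('a)" and f: "linear f"
  shows "x \<bullet> adjoint f y = f x \<bullet> y"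
proof -
  obtain S :: "'a set" where S: "finite S" "span S = UNIV"
    using fd unfolding finite_dimensional_def by blast
  have "\<forall>y. \<exists>w. \<forall>x. f x \<bullet> y = x \<bullet> w"
  proof
    fix y
    have "linear (\<lambda>x. f x \<bullet> y)"
      by (rule linearI) (simp_all add: linear_add[OF f] linear_scale[OF f] inner_add_left)
    from finite_span_riesz[OF S(1) this] obtain w where "\<forall>x. f x \<bullet> y = w \<bullet> x"
      unfolding S(2) by blast
    then have "\<forall>x. f x \<bullet> y = x \<bullet> w" by (simp only: inner_commute[of w]) simp
    then show "\<exists>w. \<forall>x. f x \<bullet> y = x \<bullet> w" ..
  qed
  from choice[OF this] obtain g where g: "\<forall>x y. f x \<bullet> y = x \<bullet> g y" by blast
  have "\<exists>g. \<forall>x y. f x \<bullet> y = x \<bullet> g y" by (rule exI[where x = g]) (rule g)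
  from someI_ex[OF this] show ?thesis unfolding adjoint_def by metis
qed

lemma adjoint_eq_self_iff:
  fixes B :: "'a::real_inner \<Rightarrow> 'a"
  assumes "finite_dimensional TYPE('a)" "linear B"
  shows "adjoint B = B \<longleftrightarrow> (\<forall>x y. B x \<bullet> y = x \<bullet> B y)"
proof
  assume "adjoint B = B"
  then show "\<forall>x y. B x \<bullet> y = x \<bullet> B y"
    using finite_dimensional_adjoint_works[OF assms] by simp
qed (rule adjoint_unique)

end

theory Submission
  imports Defs
begin

text \<open>
  The energy \<open>\<parallel>u\<parallel>\<^sup>2 + (\<Sum>i. a i * \<parallel>v i\<parallel>\<^sub>B\<^sup>2)\<close> is nonincreasing: since \<open>B\<close> is self-adjoint, the
  coupling terms \<open>a i * (B (v i) \<bullet> u)\<close> from the two kinds of equations cancel in its derivative, which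
  leaves \<open>- 2 * (A u \<bullet> u) - 2 * (\<Sum>i. a i * b i * \<parallel>v i\<parallel>\<^sub>B\<^sup>2)\<close>.
\<close>

text \<open>By \<open>finite_span_riesz\<close>, each coordinate functional of a finite basis is the
  inner product with a fixed vector, hence bounded. Expanding \<open>x\<close> in that basis makes
  \<open>f\<close> a finite sum of bounded rank-one maps. Applied to \<open>B\<close>, this gives
  continuity and the chain rule along curves.\<close>

lemma finite_dimensional_bounded_linear:
  fixes f :: "'a::real_inner \<Rightarrow> 'b::real_normed_vector"
  assumes fd: "finite_dimensional TYPE('a)" and f: "linear f"
  shows "bounded_linear f"
proof -
  obtain S :: "'a set" where S: "finite S" "span S = UNIV"
    using fd unfolding finite_dimensional_def by blast
  obtain C where C: "C \<subseteq> S" "independent C" "S \<subseteq> span C"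
    using maximal_independent_subset[of S] by blast
  have finC: "finite C" using C(1) S(1) finite_subset by blast
  have spanC: "span C = UNIV" using C(3) S(2) span_mono[OF C(3)] by (simp add: span_span top.extremum_unique)
  have "\<exists>w. \<forall>x. representation C x c = w \<bullet> x" for c
  proof -
    have "linear (\<lambda>x. representation C x c)"
      by (rule linearI) (simp_all add: representation_add representation_scale C(2) spanC)
    from finite_span_riesz[OF S(1) this] show ?thesis unfolding S(2) by blast
  qed
  then obtain w where w: "\<And>c x. representation C x c = w c \<bullet> x" by metis
  have "f x = (\<Sum>c\<in>C. (w c \<bullet> x) *\<^sub>R f c)" for x
  proof -
    have "x = (\<Sum>c\<in>C. representation C x c *\<^sub>R c)"
      using sum_representation_eq[of C x C] C(2) spanC finC by simp
    then have "f x = f (\<Sum>c\<in>C. representation C x c *\<^sub>R c)" by simp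
    then show ?thesis by (simp add: linear_sum[OF f] linear_scale[OF f] w)
  qed
  then have "f = (\<lambda>x. \<Sum>c\<in>C. (w c \<bullet> x) *\<^sub>R f c)" by blast
  moreover have "bounded_linear (\<lambda>x. \<Sum>c\<in>C. (w c \<bullet> x) *\<^sub>R f c)"
    by (intro bounded_linear_sum bounded_linear_scaleR_const bounded_linear_inner_right)
  ultimately show ?thesis by simp
qed

text \<open>\<open>pos_op\<close> is silent at \<open>0\<close>; there linearity gives the value
  \<open>0\<close>.\<close>

lemma pos_op_nonneg:
  assumes "linear B" "pos_op B"
  shows "0 \<le> B x \<bullet> x"
  using assms by (cases "x = 0") (auto simp: pos_op_def linear_0 less_imp_le)

lemma power2_norm_wrt:
  assumes "linear B" "pos_op B"
  shows "(norm_wrt B x)\<^sup>2 = B x \<bullet> x"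
  using pos_op_nonneg[OF assms] by (simp add: norm_wrt_def)

theorem theorem1:
  fixes A B :: "'a::real_inner \<Rightarrow> 'a"
    and m :: nat and a b :: "nat \<Rightarrow> real" and T :: real
    and u0 :: 'a and u :: "real \<Rightarrow> 'a" and v :: "nat \<Rightarrow> real \<Rightarrow> 'a"
  assumes "finite_dimensional TYPE('a)"
    and "linear A" and "nonneg_op A"
    and "linear B" and "adjoint B = B" and "pos_op B"
    and "m \<ge> 1"
    and "\<And>i. i \<in> {1..m} \<Longrightarrow> a i > 0"
    and "\<And>i. i \<in> {1..m} \<Longrightarrow> b i > 0"
    and "T > 0"
    and "cauchy_solution A B m a b T u0 u v"
  shows "\<forall>t\<in>{0<..T}. (norm (u t))\<^sup>2 + (\<Sum>i=1..m. a i * (norm_wrt B (v i t))\<^sup>2) \<le> (norm u0)\<^sup>2"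
proof
  fix t assume t: "t \<in> {0<..T}"
  note sol = assms(11)[unfolded cauchy_solution_def]
  have B: "bounded_linear B"
    using finite_dimensional_bounded_linear assms(1,4) by blast
  have sym: "B x \<bullet> y = x \<bullet> B y" for x y
    using adjoint_eq_self_iff[OF assms(1,4)] assms(5) by blast
  \<comment> \<open>The quadratic form replaces \<open>norm_wrt\<close>, so that the product rule
    applies without differentiating a square root.\<close>
  define E where "E s = u s \<bullet> u s + (\<Sum>i=1..m. a i * (B (v i s) \<bullet> v i s))" for s
  have sub: "{0..t} \<subseteq> {0..T}" using t by auto
  have cu: "continuous_on {0..t} u"
    using sol continuous_on_subset[OF _ sub] by blast
  have cv: "continuous_on {0..t} (v i)" if "i \<in> {1..m}" for i
    using sol that continuous_on_subset[OF _ sub] by blast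
  have "continuous_on {0..t} E"
    unfolding E_def
    by (intro continuous_intros cu cv bounded_linear.continuous_on[OF B])
  \<comment> \<open>The equations say nothing at time \<open>0\<close>, so the sign of the
    derivative is shown on the open interval only; continuity of \<open>E\<close> covers both
    ends.\<close>
  moreover have "\<exists>y. (E has_real_derivative y) (at s) \<and> y \<le> 0" if s: "0 < s" "s < t" for s
  proof -
    \<comment> \<open>Since \<open>0 < s < t \<le> T\<close>, the point is interior, and the
      one-sided case at \<open>T\<close> never arises.\<close>
    have at: "at s within {0..T} = at s"
      using s t by (intro at_within_Icc_at) auto
    have sT: "s \<in> {0<..T}" using s t by auto
    define u' where "u' = vector_derivative u (at s)"
    define v' where "v' i = vector_derivative (v i) (at s)" for i
    have du: "(u has_vector_derivative u') (at s)"
      using sol sT unfolding u'_def by (metis at vector_derivative_works)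
    have dv: "(v i has_vector_derivative v' i) (at s)" if "i \<in> {1..m}" for i
      using sol sT that unfolding v'_def by (metis at vector_derivative_works)
    have u': "u' = - A (u s) - (\<Sum>i=1..m. a i *\<^sub>R B (v i s))"
    proof -
      have "u' + A (u s) + (\<Sum>i=1..m. a i *\<^sub>R B (v i s)) = 0"
        using sol sT unfolding u'_def by (metis at)
      then show ?thesis by (simp add: algebra_simps eq_neg_iff_add_eq_0)
    qed
    have v': "v' i = u s - b i *\<^sub>R v i s" if "i \<in> {1..m}" for i
    proof -
      have "v' i + b i *\<^sub>R v i s - u s = 0"
        using sol sT that unfolding v'_def by (metis at)
      then show ?thesis by (simp add: algebra_simps)
    qed
    \<comment> \<open>\<open>D\<close> is left in the raw shape of the product rule, so that the
      derivative rules below match it syntactically.\<close>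
    define D where "D = (u s \<bullet> u' + u' \<bullet> u s)
      + (\<Sum>i=1..m. a i * (B (v i s) \<bullet> v' i + B (v' i) \<bullet> v i s))"
    have "(E has_vector_derivative D) (at s)"
      unfolding E_def D_def
      by (intro has_vector_derivative_add has_vector_derivative_sum
          bounded_linear.has_vector_derivative[OF bounded_linear_mult_right]
          bounded_bilinear.has_vector_derivative[OF bounded_bilinear_inner]
          bounded_linear.has_vector_derivative[OF B] du dv)
    then have "(E has_real_derivative D) (at s)"
      by (simp add: has_real_derivative_iff_has_vector_derivative)
    moreover have "D \<le> 0"
    proof -
      have "(\<Sum>i=1..m. a i * (B (v i s) \<bullet> v' i + B (v' i) \<bullet> v i s))
          = (\<Sum>i=1..m. 2 * (a i * (B (v i s) \<bullet> u s)) - 2 * (a i * b i * (B (v i s) \<bullet> v i s)))"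
      proof (rule sum.cong[OF refl])
        fix i assume i: "i \<in> {1..m}"
        \<comment> \<open>Self-adjointness of \<open>B\<close> enters here: both halves of the
          product rule coincide, which yields the factor 2 needed to match the coupling terms from
          \<open>u'\<close>.\<close>
        have swap: "B (v' i) \<bullet> v i s = B (v i s) \<bullet> v' i"
          by (simp add: sym inner_commute)
        show "a i * (B (v i s) \<bullet> v' i + B (v' i) \<bullet> v i s)
            = 2 * (a i * (B (v i s) \<bullet> u s)) - 2 * (a i * b i * (B (v i s) \<bullet> v i s))"
          unfolding swap by (simp add: v'[OF i] inner_diff_right algebra_simps)
      qed
      moreover have "u s \<bullet> u' + u' \<bullet> u s
          = - 2 * (A (u s) \<bullet> u s) - 2 * (\<Sum>i=1..m. a i * (B (v i s) \<bullet> u s))"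
        by (simp add: u' inner_diff_left inner_diff_right inner_sum_left inner_sum_right
              inner_commute[of "u s"])
      ultimately have "D = - 2 * (A (u s) \<bullet> u s)
          - 2 * (\<Sum>i=1..m. a i * b i * (B (v i s) \<bullet> v i s))"
        by (simp add: D_def sum_subtractf flip: sum_distrib_left)
      moreover have "0 \<le> A (u s) \<bullet> u s"
        using assms(3) by (simp add: nonneg_op_def)
      moreover have "0 \<le> (\<Sum>i=1..m. a i * b i * (B (v i s) \<bullet> v i s))"
        using assms(8,9) pos_op_nonneg[OF assms(4,6)]
        by (intro sum_nonneg mult_nonneg_nonneg) (auto simp: less_imp_le)
      ultimately show ?thesis by simp
    qed
    ultimately show ?thesis by blast
  qed
  ultimately have "E t \<le> E 0"
    using t by (intro DERIV_nonpos_imp_decreasing_open[of 0 t E]) auto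
  \<comment> \<open>The auxiliary functions start at zero, so only the \<open>u\<close> term
    survives.\<close>
  also have "E 0 = (norm u0)\<^sup>2"
    using sol by (simp add: E_def power2_norm_eq_inner)
  finally show "(norm (u t))\<^sup>2 + (\<Sum>i=1..m. a i * (norm_wrt B (v i t))\<^sup>2) \<le> (norm u0)\<^sup>2"
    by (simp add: E_def power2_norm_wrt[OF assms(4,6)] power2_norm_eq_inner)
qed

end
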